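(* Let $\{x_m\}_{m\ge 0}$ be an arbitrary sequence of vectors in $\mathbb{C}^N$, let $k$ be an integer with $1\le k<k_0$, and suppose that $s_k^{\mathrm{MPE}}$ exists. Then $$\frac{1}{[\![U_k\gamma_k^{\mathrm{RRE}}]\!]^2}=\frac{1}{[\![U_{k-1}\gamma_{k-1}^{\mathrm{RRE}}]\!]^2}+\frac{1}{[\![U_k\gamma_k^{\mathrm{MPE}}]\!]^2}$$ and $$\frac{U_k\gamma_k^{\mathrm{RRE}}}{[\![U_k\gamma_k^{\mathrm{RRE}}]\!]^2}=\frac{U_{k-1}\gamma_{k-1}^{\mathrm{RRE}}}{[\![U_{k-1}\gamma_{k-1}^{\mathrm{RRE}}]\!]^2}+\frac{U_k\gamma_k^{\mathrm{MPE}}}{[\![U_k\gamma_k^{\mathrm{MPE}}]\!]^2}.$$ Consequently, also $$\frac{s_k^{\mathrm{RRE}}}{[\![U_k\gamma_k^{\mathrm{RRE}}]\!]^2}=\frac{s_{k-1}^{\mathrm{RRE}}}{[\![U_{k-1}\gamma_{k-1}^{\mathrm{RRE}}]\!]^2}+\frac{s_k^{\mathrm{MPE}}}{[\![U_k\gamma_k^{\mathrm{MPE}}]\!]^2}.$$ In addition, $$[\![U_k\gamma_k^{\mathrm{RRE}}]\!]<[\![U_{k-1}\gamma_{k-1}^{\mathrm{RRE}}]\!].$$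
   Context: Fix a hermitian positive definite matrix $M\in\mathbb{C}^{N\times N}$ and let $\langle y,z\rangle=y^*Mz$ and $[\![z]\!]=\sqrt{z^*Mz}$ for $y,z\in\mathbb{C}^N$. Given a sequence $\{x_m\}_{m\ge0}$ in $\mathbb{C}^N$, set $u_i=x_{i+1}-x_i$ and $U_k=[u_0\,|\,u_1\,|\cdots|\,u_k]\in\mathbb{C}^{N\times(k+1)}$. Let $k_0\le N$ be the integer such that $\operatorname{rank}(U_k)=k+1$ for $k=0,1,\dots,k_0-1$ and $\operatorname{rank}(U_{k_0})=k_0$; that is, $\{u_0,\dots,u_{k_0-1}\}$ is linearly independent but $\{u_0,\dots,u_{k_0}\}$ is not. Both methods produce vectors of the form $s_k=\sum_{i=0}^k\gamma_i x_i$ with $\sum_{i=0}^k\gamma_i=1$; write $\gamma_k=[\gamma_{k0},\dots,\gamma_{kk}]^T\in\mathbb{C}^{k+1}$ for the vector of coefficients belonging to $s_k$ (superscript MPE or RRE indicates the method). MPE (Minimal Polynomial Extrapolation), for $k<k_0$: let $c'=[c_0,\dots,c_{k-1}]^T\in\mathbb{C}^k$ be the unique minimizer of $[\![U_{k-1}c'+u_k]\!]$, and set $c_k=1$. If $\sum_{i=0}^k c_i\neq0$, then $\gamma_i=c_i/\sum_{j=0}^k c_j$, $i=0,\dots,k$, giving $\gamma_k^{\mathrm{MPE}}$, and $s_k^{\mathrm{MPE}}=\sum_{i=0}^k\gamma_ix_i$. We say that $s_k^{\mathrm{MPE}}$ exists if and only if $\sum_{i=0}^k c_i\neq0$. (For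 $k=0$ there is no minimization, $c_0=1$, and $s_0^{\mathrm{MPE}}=x_0$.) RRE (Reduced Rank Extrapolation), for $k<k_0$: $\gamma_k^{\mathrm{RRE}}$ is the unique minimizer of $[\![U_k\gamma]\!]$ over all $\gamma\in\mathbb{C}^{k+1}$ with $\sum_{i=0}^k\gamma_i=1$, and $s_k^{\mathrm{RRE}}=\sum_{i=0}^k\gamma_{ki}^{\mathrm{RRE}}x_i$ (this always exists). *)

theory Defs
  imports "Jordan_Normal_Form.DL_Rank" "Jordan_Normal_Form.Schur_Decomposition"
begin

definition m_inner :: "complex mat \<Rightarrow> complex vec \<Rightarrow> complex vec \<Rightarrow> complex" where
  "m_inner M y z = conjugate y \<bullet> (M *\<^sub>v z)"

text \<open>For hermitian \<open>M\<close> the number \<open>m_inner M z z\<close> is real, so that taking the real part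
  in the following two definitions loses nothing.\<close>

definition hermitian_pos_def :: "nat \<Rightarrow> complex mat \<Rightarrow> bool" where
  "hermitian_pos_def N M \<longleftrightarrow>
     M \<in> carrier_mat N N \<and> mat_adjoint M = M \<and>
     (\<forall>z\<in>carrier_vec N. z \<noteq> 0\<^sub>v N \<longrightarrow> 0 < Re (m_inner M z z))"

definition m_norm :: "complex mat \<Rightarrow> complex vec \<Rightarrow> real" where
  "m_norm M z = sqrt (Re (m_inner M z z))"

definition diff_vec :: "(nat \<Rightarrow> complex vec) \<Rightarrow> nat \<Rightarrow> complex vec" where
  "diff_vec x i = x (Suc i) - x i"

text \<open>The matrix \<open>diff_mat N x k\<close> is $U_k$; it has \<open>k + 1\<close> columns.\<close>

definition diff_mat :: "nat \<Rightarrow> (nat \<Rightarrow> complex vec) \<Rightarrow> nat \<Rightarrow> complex mat" where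
  "diff_mat N x k = mat_of_cols N (map (diff_vec x) [0..<Suc k])"

text \<open>The condition that determines the integer $k_0$.\<close>

definition is_break_index :: "nat \<Rightarrow> (nat \<Rightarrow> complex vec) \<Rightarrow> nat \<Rightarrow> bool" where
  "is_break_index N x k0 \<longleftrightarrow>
     k0 \<le> N \<and>
     (\<forall>k<k0. vec_space.rank N (diff_mat N x k) = k + 1) \<and>
     vec_space.rank N (diff_mat N x k0) = k0"

definition extrapolant :: "nat \<Rightarrow> (nat \<Rightarrow> complex vec) \<Rightarrow> nat \<Rightarrow> complex vec \<Rightarrow> complex vec" where
  "extrapolant N x k g = finsum_vec TYPE(complex) N (\<lambda>i. g $ i \<cdot>\<^sub>v x i) {0..k}"

text \<open>The minimizers below are unique when \<open>M\<close> is hermitian positive definite and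
  \<open>k\<close> is smaller than the break index. \<open>mpe_min\<close> is meaningful only for \<open>k \<ge> 1\<close>;
  for \<open>k = 0\<close> the definition of \<open>mpe_c\<close> does not use it and yields the vector \<open>[1]\<close>.\<close>

definition mpe_min :: "nat \<Rightarrow> complex mat \<Rightarrow> (nat \<Rightarrow> complex vec) \<Rightarrow> nat \<Rightarrow> complex vec" where
  "mpe_min N M x k =
     (THE c. is_arg_min (\<lambda>c. m_norm M (diff_mat N x (k - 1) *\<^sub>v c + diff_vec x k))
               (\<lambda>c. c \<in> carrier_vec k) c)"

definition mpe_c :: "nat \<Rightarrow> complex mat \<Rightarrow> (nat \<Rightarrow> complex vec) \<Rightarrow> nat \<Rightarrow> complex vec" where
  "mpe_c N M x k = vec (k + 1) (\<lambda>i. if i < k then mpe_min N M x k $ i else 1)"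

definition mpe_exists :: "nat \<Rightarrow> complex mat \<Rightarrow> (nat \<Rightarrow> complex vec) \<Rightarrow> nat \<Rightarrow> bool" where
  "mpe_exists N M x k \<longleftrightarrow> (\<Sum>i=0..k. mpe_c N M x k $ i) \<noteq> 0"

definition mpe_gamma :: "nat \<Rightarrow> complex mat \<Rightarrow> (nat \<Rightarrow> complex vec) \<Rightarrow> nat \<Rightarrow> complex vec" where
  "mpe_gamma N M x k =
     vec (k + 1) (\<lambda>i. mpe_c N M x k $ i / (\<Sum>j=0..k. mpe_c N M x k $ j))"

definition mpe_s :: "nat \<Rightarrow> complex mat \<Rightarrow> (nat \<Rightarrow> complex vec) \<Rightarrow> nat \<Rightarrow> complex vec" where
  "mpe_s N M x k = extrapolant N x k (mpe_gamma N M x k)"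

definition rre_gamma :: "nat \<Rightarrow> complex mat \<Rightarrow> (nat \<Rightarrow> complex vec) \<Rightarrow> nat \<Rightarrow> complex vec" where
  "rre_gamma N M x k =
     (THE g. is_arg_min (\<lambda>g. m_norm M (diff_mat N x k *\<^sub>v g))
               (\<lambda>g. g \<in> carrier_vec (k + 1) \<and> (\<Sum>i=0..k. g $ i) = 1) g)"

definition rre_s :: "nat \<Rightarrow> complex mat \<Rightarrow> (nat \<Rightarrow> complex vec) \<Rightarrow> nat \<Rightarrow> complex vec" where
  "rre_s N M x k = extrapolant N x k (rre_gamma N M x k)"

text \<open>The vectors $U_k\gamma_k$ for the two methods.\<close>

definition mpe_res :: "nat \<Rightarrow> complex mat \<Rightarrow> (nat \<Rightarrow> complex vec) \<Rightarrow> nat \<Rightarrow> complex vec" where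
  "mpe_res N M x k = diff_mat N x k *\<^sub>v mpe_gamma N M x k"

definition rre_res :: "nat \<Rightarrow> complex mat \<Rightarrow> (nat \<Rightarrow> complex vec) \<Rightarrow> nat \<Rightarrow> complex vec" where
  "rre_res N M x k = diff_mat N x k *\<^sub>v rre_gamma N M x k"

end

theory Submission
  imports Defs
begin

text \<open>
  Both methods minimize $[\![U_k\gamma]\!]$ under a single linear constraint on \<open>\<gamma>\<close>: the
  entries of \<open>\<gamma>\<close> sum to 1 for RRE, and the last entry is 1 for MPE, where the minimizer is
  rescaled afterwards to have entry sum 1. As the columns of $U_k$ are independent, such a problem
  has exactly one solution, and the solution is the feasible vector whose image is orthogonal to
  $U_k\delta$ for every \<open>\<delta>\<close> that satisfies the homogeneous constraint
  (\<open>stationary_exists\<close>, \<open>stationary_strict_min\<close>).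

  Let $p = U_{k-1}\gamma_{k-1}^{RRE}$ and $q = U_k\gamma_k^{MPE}$, with squared norms \<open>P\<close> and \<open>Q\<close>.
  For MPE the orthogonality says that \<open>q\<close> is orthogonal to $u_0,\dots,u_{k-1}$, hence to \<open>p\<close>.
  The key step (\<open>rre_gamma_weighted_mean\<close>) is that $\gamma_k^{RRE}$ is the weighted mean of
  $\gamma_{k-1}^{RRE}$, extended by a zero, and $\gamma_k^{MPE}$, with weights \<open>Q / (P + Q)\<close> and
  \<open>P / (P + Q)\<close>. Indeed this mean has entry sum 1, and its image $(Qp + Pq)/(P+Q)$ is orthogonal to
  $U_k\delta$ for each \<open>\<delta>\<close> with entry sum 0: such a \<open>\<delta>\<close> is a multiple of the difference of the two
  coefficient vectors plus a vector with entry sum 0 and last entry 0. The latter has image orthogonal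
  to \<open>p\<close>, because \<open>p\<close> solves the smaller RRE problem, and to \<open>q\<close>; and
  $\langle q-p, Qp+Pq\rangle = PQ - QP = 0$. The weights are exactly those for which this last
  expression vanishes.

  By Pythagoras the squared norm of the mean of \<open>p\<close> and \<open>q\<close> is \<open>P * Q / (P + Q)\<close>, the reciprocal
  of \<open>1 / P + 1 / Q\<close>, and hence smaller than \<open>P\<close>. Division of the mean by this number gives the identity for the residuals, and
  the same division gives the identity for the extrapolants since these depend linearly on the
  coefficients.
\<close>

section \<open>Inner product given by a positive definite matrix\<close>

lemma conjugate_complex_eq_cnj [simp]: "conjugate (z :: complex) = cnj z"
  by (simp add: conjugate_complex_def)

lemma mat_adjoint_carrier: "A \<in> carrier_mat n m \<Longrightarrow> mat_adjoint A \<in> carrier_mat m n"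
  unfolding mat_adjoint_def mat_of_rows_def by auto

lemma mat_adjoint_scalar_prod:
  fixes A :: "complex mat"
  assumes A: "A \<in> carrier_mat n m" and v: "v \<in> carrier_vec m" and y: "y \<in> carrier_vec n"
  shows "conjugate (A *\<^sub>v v) \<bullet> y = conjugate v \<bullet> (mat_adjoint A *\<^sub>v y)"
proof -
  have Av: "A *\<^sub>v v \<in> carrier_vec n"
    using A v by simp
  have "conjugate (A *\<^sub>v v) \<bullet> y = (\<Sum>j<n. \<Sum>i<m. cnj (A $$ (j,i)) * cnj (v $ i) * y $ j)"
    using A v y Av
    by (auto simp: scalar_prod_def atLeast0LessThan sum_distrib_right intro!: sum.cong)
  also have "\<dots> = (\<Sum>i<m. \<Sum>j<n. cnj (A $$ (j,i)) * cnj (v $ i) * y $ j)"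
    by (rule sum.swap)
  also have "\<dots> = conjugate v \<bullet> (mat_adjoint A *\<^sub>v y)"
    using A v y
    by (auto simp: scalar_prod_def atLeast0LessThan sum_distrib_left mat_adjoint_def
        intro!: sum.cong)
  finally show ?thesis .
qed

locale pos_def_mat =
  fixes N :: nat and M :: "complex mat"
  assumes pos_def: "hermitian_pos_def N M"
begin

lemma M_carrier [simp]: "M \<in> carrier_mat N N"
  and M_selfadjoint: "mat_adjoint M = M"
  using pos_def by (auto simp: hermitian_pos_def_def)

lemma m_inner_add_right:
  assumes "y \<in> carrier_vec N" "z \<in> carrier_vec N" "w \<in> carrier_vec N"
  shows "m_inner M y (z + w) = m_inner M y z + m_inner M y w"
  unfolding m_inner_def
  using assms by (simp add: mult_add_distrib_mat_vec[OF M_carrier] scalar_prod_add_distrib[of _ N]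
      mult_mat_vec_carrier[OF M_carrier])

lemma m_inner_smult_right:
  assumes "y \<in> carrier_vec N" "z \<in> carrier_vec N"
  shows "m_inner M y (a \<cdot>\<^sub>v z) = a * m_inner M y z"
  unfolding m_inner_def
  using assms by (simp add: mult_mat_vec[OF M_carrier] scalar_prod_smult_distrib[of _ N]
      mult_mat_vec_carrier[OF M_carrier])

lemma m_inner_commute:
  assumes y: "y \<in> carrier_vec N" and z: "z \<in> carrier_vec N"
  shows "m_inner M y z = cnj (m_inner M z y)"
proof -
  have My: "M *\<^sub>v y \<in> carrier_vec N" and Mz: "M *\<^sub>v z \<in> carrier_vec N"
    using y z by (simp_all add: mult_mat_vec_carrier[OF M_carrier])
  have "m_inner M y z = conjugate (M *\<^sub>v y) \<bullet> z"
    using mat_adjoint_scalar_prod[OF M_carrier y z] by (simp add: m_inner_def M_selfadjoint)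
  also have "\<dots> = z \<bullet> conjugate (M *\<^sub>v y)"
    using My z by (intro comm_scalar_prod[of _ N]) simp_all
  also have "\<dots> = cnj (m_inner M z y)"
    using conjugate_conjugate_sprod[OF z My] by (simp add: m_inner_def)
  finally show ?thesis .
qed

lemma m_inner_add_left:
  assumes "y \<in> carrier_vec N" "z \<in> carrier_vec N" "w \<in> carrier_vec N"
  shows "m_inner M (y + z) w = m_inner M y w + m_inner M z w"
  using assms m_inner_commute[of "y + z" w] m_inner_commute[of y w] m_inner_commute[of z w]
  by (simp add: m_inner_add_right)

lemma m_inner_smult_left:
  assumes "y \<in> carrier_vec N" "z \<in> carrier_vec N"
  shows "m_inner M (a \<cdot>\<^sub>v y) z = cnj a * m_inner M y z"
  using assms m_inner_commute[of "a \<cdot>\<^sub>v y" z] m_inner_commute[of y z]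
  by (simp add: m_inner_smult_right)

lemma m_inner_zero [simp]: "m_inner M (0\<^sub>v N) (0\<^sub>v N) = 0"
  using scalar_prod_left_zero[OF mult_mat_vec_carrier[OF M_carrier zero_carrier_vec]]
  by (simp add: m_inner_def)

lemma m_inner_self_nonneg: "z \<in> carrier_vec N \<Longrightarrow> 0 \<le> Re (m_inner M z z)"
  using pos_def by (cases "z = 0\<^sub>v N") (auto simp: hermitian_pos_def_def intro: less_imp_le)

lemma m_norm_power2: "z \<in> carrier_vec N \<Longrightarrow> (m_norm M z)\<^sup>2 = Re (m_inner M z z)"
  by (simp add: m_norm_def m_inner_self_nonneg)

lemma m_inner_self:
  assumes "z \<in> carrier_vec N"
  shows "m_inner M z z = complex_of_real ((m_norm M z)\<^sup>2)"
proof -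
  have "Im (m_inner M z z) = 0"
    using arg_cong[OF m_inner_commute[OF assms assms], of Im] by simp
  then show ?thesis
    by (simp add: complex_eq_iff m_norm_power2 assms flip: of_real_power)
qed

lemma m_norm_nonneg: "z \<in> carrier_vec N \<Longrightarrow> 0 \<le> m_norm M z"
  by (simp add: m_norm_def m_inner_self_nonneg)

lemma m_norm_pos: "z \<in> carrier_vec N \<Longrightarrow> z \<noteq> 0\<^sub>v N \<Longrightarrow> 0 < m_norm M z"
  using pos_def by (simp add: m_norm_def hermitian_pos_def_def)

lemma m_norm_pythagoras:
  assumes "y \<in> carrier_vec N" "z \<in> carrier_vec N" "m_inner M y z = 0"
  shows "(m_norm M (y + z))\<^sup>2 = (m_norm M y)\<^sup>2 + (m_norm M z)\<^sup>2"
  using assms m_inner_commute[of z y]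
  by (simp add: m_norm_power2 m_inner_add_left m_inner_add_right)

end


section \<open>Least squares under one linear constraint\<close>

text \<open>The predicate \<open>stationary M A e g\<close> is the first-order optimality condition for minimizing the
  \<open>M\<close>-norm of \<open>A *\<^sub>v g\<close> over the hyperplane \<open>e \<bullet> g = 1\<close>. The product \<open>e \<bullet> g\<close> is bilinear,
  so that the constraint is linear in \<open>g\<close> over the complex numbers.\<close>

definition stationary :: "complex mat \<Rightarrow> complex mat \<Rightarrow> complex vec \<Rightarrow> complex vec \<Rightarrow> bool" where
  "stationary M A e g \<longleftrightarrow>
     g \<in> carrier_vec (dim_col A) \<and> e \<bullet> g = 1 \<and>
     (\<forall>d\<in>carrier_vec (dim_col A). e \<bullet> d = 0 \<longrightarrow> m_inner M (A *\<^sub>v d) (A *\<^sub>v g) = 0)"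

context pos_def_mat
begin

text \<open>Injectivity of \<open>A\<close> makes its Gram matrix $G = A^*MA$ invertible. If $h$ solves $Gh = \bar e$,
  then $\langle Ad, Ah\rangle = \overline{e \cdot d}$ for all $d$, so \<open>h\<close> has the required
  orthogonality. Taking $d = h$ gives $e \cdot h \neq 0$, and a rescaling of \<open>h\<close> is feasible.\<close>

lemma stationary_exists:
  assumes A: "A \<in> carrier_mat N n"
    and inj: "\<And>v. v \<in> carrier_vec n \<Longrightarrow> A *\<^sub>v v = 0\<^sub>v N \<Longrightarrow> v = 0\<^sub>v n"
    and e: "e \<in> carrier_vec n" "e \<noteq> 0\<^sub>v n"
  obtains g where "stationary M A e g"
proof -
  define G where "G = mat_adjoint A * (M * A)"
  have MA: "M * A \<in> carrier_mat N n"
    using A by (metis M_carrier mult_carrier_mat)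
  have G: "G \<in> carrier_mat n n"
    unfolding G_def using mat_adjoint_carrier[OF A] MA by simp
  have gram: "m_inner M (A *\<^sub>v d) (A *\<^sub>v g) = conjugate d \<bullet> (G *\<^sub>v g)"
    if "d \<in> carrier_vec n" "g \<in> carrier_vec n" for d g
  proof -
    have Ag: "A *\<^sub>v g \<in> carrier_vec N"
      using A that by simp
    have "G *\<^sub>v g = mat_adjoint A *\<^sub>v (M *\<^sub>v (A *\<^sub>v g))"
      unfolding G_def
      using assoc_mult_mat_vec[OF mat_adjoint_carrier[OF A] MA that(2)]
        assoc_mult_mat_vec[OF M_carrier A that(2)] by simp
    then show ?thesis
      unfolding m_inner_def
      using mat_adjoint_scalar_prod[OF A that(1) mult_mat_vec_carrier[OF M_carrier Ag]] by simp
  qed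
  have "\<not> (\<exists>v. v \<in> carrier_vec n \<and> v \<noteq> 0\<^sub>v n \<and> G *\<^sub>v v = 0\<^sub>v n)"
  proof safe
    fix v assume v: "v \<in> carrier_vec n" "v \<noteq> 0\<^sub>v n" "G *\<^sub>v v = 0\<^sub>v n"
    have "m_inner M (A *\<^sub>v v) (A *\<^sub>v v) = 0"
      using gram[OF v(1) v(1)] v by simp
    moreover have "A *\<^sub>v v \<in> carrier_vec N" "A *\<^sub>v v \<noteq> 0\<^sub>v N"
      using A v inj by auto
    ultimately show False
      using m_norm_pos[of "A *\<^sub>v v"] by (simp add: m_norm_def)
  qed
  then have "det G \<noteq> 0"
    using det_0_iff_vec_prod_zero_field[OF G] by blast
  from det_non_zero_imp_unit[OF G this, of n]
  obtain B where B: "B \<in> carrier_mat n n" "G * B = 1\<^sub>m n"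
    by (auto simp: Units_def ring_mat_def)
  define h where "h = B *\<^sub>v conjugate e"
  have h: "h \<in> carrier_vec n"
    unfolding h_def using B e by (simp add: mult_mat_vec_carrier)
  have Gh: "G *\<^sub>v h = conjugate e"
    unfolding h_def using assoc_mult_mat_vec[OF G B(1), of "conjugate e"] B e by simp
  have inner_h: "m_inner M (A *\<^sub>v d) (A *\<^sub>v h) = cnj (e \<bullet> d)" if "d \<in> carrier_vec n" for d
    using that e comm_scalar_prod[OF that e(1)] conjugate_sprod_vec[OF that e(1)]
    by (simp add: gram h Gh)
  have "G *\<^sub>v 0\<^sub>v n = 0\<^sub>v n"
    using G by auto
  then have "h \<noteq> 0\<^sub>v n"
    using Gh e by auto
  then have "A *\<^sub>v h \<noteq> 0\<^sub>v N" "A *\<^sub>v h \<in> carrier_vec N"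
    using inj h A by auto
  then have "m_inner M (A *\<^sub>v h) (A *\<^sub>v h) \<noteq> 0"
    using m_norm_pos[of "A *\<^sub>v h"] by (auto simp: m_norm_def)
  then have eh: "e \<bullet> h \<noteq> 0"
    using inner_h[OF h] by simp
  have "stationary M A e ((1 / (e \<bullet> h)) \<cdot>\<^sub>v h)"
    unfolding stationary_def
    using A h e eh by (auto simp: mult_mat_vec[OF A] m_inner_smult_right inner_h)
  then show thesis
    by (rule that)
qed

text \<open>A feasible \<open>h\<close> differs from \<open>g\<close> by a vector satisfying the homogeneous constraint, so
  Pythagoras applies. This yields at once that \<open>g\<close> is a minimizer and that it is the only one.\<close>

lemma stationary_strict_min:
  assumes A: "A \<in> carrier_mat N n"
    and inj: "\<And>v. v \<in> carrier_vec n \<Longrightarrow> A *\<^sub>v v = 0\<^sub>v N \<Longrightarrow> v = 0\<^sub>v n"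
    and e: "e \<in> carrier_vec n"
    and g: "stationary M A e g"
    and h: "h \<in> carrier_vec n" "e \<bullet> h = 1" "h \<noteq> g"
  shows "m_norm M (A *\<^sub>v g) < m_norm M (A *\<^sub>v h)"
proof -
  have gc: "g \<in> carrier_vec n" "e \<bullet> g = 1"
    using g A by (auto simp: stationary_def)
  define d where "d = h - g"
  have d: "d \<in> carrier_vec n" "e \<bullet> d = 0"
    using h gc e by (auto simp: d_def scalar_prod_minus_distrib[of _ n])
  have hd: "h = d + g"
    unfolding d_def using h gc by (intro eq_vecI) auto
  have "d \<noteq> 0\<^sub>v n"
    using hd h gc by auto
  then have Ad: "A *\<^sub>v d \<noteq> 0\<^sub>v N" "A *\<^sub>v d \<in> carrier_vec N" and Ag: "A *\<^sub>v g \<in> carrier_vec N"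
    using inj d A gc by auto
  have "(m_norm M (A *\<^sub>v h))\<^sup>2 = (m_norm M (A *\<^sub>v d))\<^sup>2 + (m_norm M (A *\<^sub>v g))\<^sup>2"
    unfolding hd mult_add_distrib_mat_vec[OF A d(1) gc(1)]
    using g d A by (intro m_norm_pythagoras Ad Ag) (auto simp: stationary_def)
  then have "(m_norm M (A *\<^sub>v g))\<^sup>2 < (m_norm M (A *\<^sub>v h))\<^sup>2"
    using m_norm_pos[OF Ad(2,1)] by simp
  moreover have "0 \<le> m_norm M (A *\<^sub>v h)"
    using A h by (intro m_norm_nonneg) auto
  ultimately show ?thesis
    by (rule power_less_imp_less_base)
qed

end

lemma the_is_arg_min_eq:
  fixes f :: "'a \<Rightarrow> real"
  assumes "P g" and "\<And>h. P h \<Longrightarrow> h \<noteq> g \<Longrightarrow> f g < f h"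
  shows "(THE h. is_arg_min f P h) = g"
proof (rule the_equality)
  show "is_arg_min f P g"
    unfolding is_arg_min_def using assms by (metis less_asym)
  show "h = g" if "is_arg_min f P h" for h
    using that assms unfolding is_arg_min_def by blast
qed


section \<open>Difference matrices\<close>

text \<open>The rank is the dimension of the span of the \<^emph>\<open>set\<close> of columns, so full column rank also
  rules out repeated columns; only then does independence of that set say something about all
  coefficient vectors.\<close>

lemma full_column_rank_injective:
  fixes A :: "complex mat"
  assumes A: "A \<in> carrier_mat n m" and rank: "vec_space.rank n A = m"
    and v: "v \<in> carrier_vec m" "A *\<^sub>v v = 0\<^sub>v n"
  shows "v = 0\<^sub>v m"
proof -
  interpret vec_space "TYPE(complex)" n .
  obtain S where S: "maximal S (\<lambda>T. T \<subseteq> set (cols A) \<and> lin_indpt T)"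
    using maximal_exists[of "\<lambda>T. T \<subseteq> set (cols A) \<and> lin_indpt T" "card (set (cols A))" "{}"]
    by (meson List.finite_set card_mono empty_iff empty_subsetI finite_lin_indpt2 rev_finite_subset)
  have "m = card S"
    using rank_card_indpt[OF A S] rank by simp
  also have "\<dots> \<le> card (set (cols A))"
    using S by (intro card_mono) (auto simp: maximal_def)
  finally have "distinct (cols A)"
    using A card_length[of "cols A"] by (intro card_distinct) auto
  then show ?thesis
    using lin_depI[OF A v(1) _ v(2)] full_rank_lin_indpt[OF A rank] by blast
qed

text \<open>Appending an entry relates the coefficient vectors of steps \<open>k - 1\<close> and \<open>k\<close>: a 0 embeds the
  smaller RRE problem into the larger one, and a 1 turns the unknowns of MPE into a
  full vector of coefficients.\<close>

definition snoc_vec :: "complex vec \<Rightarrow> complex \<Rightarrow> complex vec" where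
  "snoc_vec c t = vec (dim_vec c + 1) (\<lambda>i. if i < dim_vec c then c $ i else t)"

lemma snoc_vec_carrier [simp]: "c \<in> carrier_vec k \<Longrightarrow> snoc_vec c t \<in> carrier_vec (k + 1)"
  by (auto simp: snoc_vec_def)

lemmas [simp] = snoc_vec_carrier [simplified]

lemma snoc_vec_cases:
  assumes "v \<in> carrier_vec (k + 1)"
  obtains c where "c \<in> carrier_vec k" "v = snoc_vec c (v $ k)"
proof
  show "vec k (($) v) \<in> carrier_vec k"
    by simp
  show "v = snoc_vec (vec k (($) v)) (v $ k)"
    using assms by (intro eq_vecI) (auto simp: snoc_vec_def less_Suc_eq)
qed

lemma snoc_vec_last: "c \<in> carrier_vec k \<Longrightarrow> snoc_vec c t $ k = t"
  by (auto simp: snoc_vec_def)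

lemma snoc_vec_inject:
  assumes "c \<in> carrier_vec k" "d \<in> carrier_vec k" "snoc_vec c t = snoc_vec d t"
  shows "c = d"
proof (rule eq_vecI)
  fix i assume "i < dim_vec d"
  then have "snoc_vec c t $ i = c $ i" "snoc_vec d t $ i = d $ i"
    using assms(1,2) by (auto simp: snoc_vec_def)
  then show "c $ i = d $ i"
    using assms(3) by simp
qed (use assms in auto)

lemma sum_snoc_vec:
  assumes "c \<in> carrier_vec k" "1 \<le> k"
  shows "(\<Sum>i=0..k. f i (snoc_vec c t $ i)) = (\<Sum>i=0..k - 1. f i (c $ i)) + f k t"
proof -
  obtain m where k: "k = Suc m"
    using assms(2) by (cases k) auto
  show ?thesis
    using assms unfolding k by (auto simp: snoc_vec_def)
qed

abbreviation ones :: "nat \<Rightarrow> complex vec" where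
  "ones n \<equiv> vec n (\<lambda>_. 1)"

lemma ones_scalar_prod: "g \<in> carrier_vec (k + 1) \<Longrightarrow> ones (k + 1) \<bullet> g = (\<Sum>i=0..k. g $ i)"
  by (auto simp: scalar_prod_def atLeast0AtMost atLeast0LessThan lessThan_Suc_atMost)

lemma unit_vec_last_scalar_prod:
  fixes g :: "complex vec"
  assumes "g \<in> carrier_vec (k + 1)"
  shows "unit_vec (k + 1) k \<bullet> g = g $ k"
  by (rule scalar_prod_left_unit[OF assms]) simp

lemma ones_nonzero: "ones (k + 1) \<noteq> 0\<^sub>v (k + 1)"
proof
  assume "ones (k + 1) = 0\<^sub>v (k + 1)"
  from arg_cong[OF this, of "\<lambda>v. v $ 0"] show False by simp
qed

lemma diff_mat_carrier [simp]: "diff_mat N x k \<in> carrier_mat N (k + 1)"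
  using mat_of_cols_carrier(1)[of N "map (diff_vec x) [0..<Suc k]"]
  by (simp add: diff_mat_def del: upt_Suc)

lemma diff_mat_mult_index:
  assumes x: "\<And>m. x m \<in> carrier_vec N" and g: "g \<in> carrier_vec (k + 1)" and j: "j < N"
  shows "(diff_mat N x k *\<^sub>v g) $ j = (\<Sum>i=0..k. g $ i * diff_vec x i $ j)"
proof -
  have d: "diff_vec x i \<in> carrier_vec N" for i
    using x by (simp add: diff_vec_def)
  have "(diff_mat N x k *\<^sub>v g) $ j = (\<Sum>i=0..<Suc k. diff_mat N x k $$ (j, i) * g $ i)"
    using g j diff_mat_carrier[of N x k] by (auto simp: scalar_prod_def intro!: sum.cong)
  also have "\<dots> = (\<Sum>i=0..<Suc k. g $ i * diff_vec x i $ j)"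
  proof (rule sum.cong)
    fix i assume "i \<in> {0..<Suc k}"
    then have "map (diff_vec x) [0..<Suc k] ! i = diff_vec x i" "i < Suc k"
      by (auto simp del: upt_Suc)
    then show "diff_mat N x k $$ (j, i) * g $ i = g $ i * diff_vec x i $ j"
      using j by (simp add: diff_mat_def mat_of_cols_index del: upt_Suc)
  qed simp
  finally show ?thesis
    by (simp add: atLeast0LessThan atLeast0AtMost lessThan_Suc_atMost)
qed

lemma diff_mat_mult_snoc_vec:
  assumes x: "\<And>m. x m \<in> carrier_vec N" and c: "c \<in> carrier_vec k" and k: "1 \<le> k"
  shows "diff_mat N x k *\<^sub>v snoc_vec c t = diff_mat N x (k - 1) *\<^sub>v c + t \<cdot>\<^sub>v diff_vec x k"
proof (rule eq_vecI)
  have d: "diff_vec x k \<in> carrier_vec N"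
    using x by (simp add: diff_vec_def)
  fix j assume "j < dim_vec (diff_mat N x (k - 1) *\<^sub>v c + t \<cdot>\<^sub>v diff_vec x k)"
  then have j: "j < N"
    using d by simp
  have c': "c \<in> carrier_vec (k - 1 + 1)"
    using c k by simp
  show "(diff_mat N x k *\<^sub>v snoc_vec c t) $ j =
      (diff_mat N x (k - 1) *\<^sub>v c + t \<cdot>\<^sub>v diff_vec x k) $ j"
    using j d diff_mat_carrier[of N x "k - 1"]
      sum_snoc_vec[OF c k, of "\<lambda>i a. a * diff_vec x i $ j" t]
    by (simp add: diff_mat_mult_index[OF x snoc_vec_carrier[OF c] j]
        diff_mat_mult_index[OF x c' j] del: index_mult_mat_vec One_nat_def)
qed (use x[of k] in \<open>simp add: diff_vec_def diff_mat_def\<close>)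

lemma diff_mat_mult_snoc_vec_zero:
  assumes x: "\<And>m. x m \<in> carrier_vec N" and c: "c \<in> carrier_vec k" and k: "1 \<le> k"
  shows "diff_mat N x k *\<^sub>v snoc_vec c 0 = diff_mat N x (k - 1) *\<^sub>v c"
proof -
  have "diff_vec x k \<in> carrier_vec N"
    using x by (simp add: diff_vec_def)
  then have "0 \<cdot>\<^sub>v diff_vec x k = 0\<^sub>v N"
    by auto
  moreover have "diff_mat N x (k - 1) *\<^sub>v c \<in> carrier_vec N"
    using diff_mat_carrier[of N x "k - 1"] c k by (auto intro!: mult_mat_vec_carrier)
  ultimately show ?thesis
    by (simp add: diff_mat_mult_snoc_vec[where x = x, OF x c k])
qed

lemma extrapolant_carrier [simp]:
  assumes "\<And>m. x m \<in> carrier_vec N"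
  shows "extrapolant N x k g \<in> carrier_vec N"
  unfolding extrapolant_def using assms by (intro finsum_vec_closed) auto

lemma extrapolant_index:
  assumes "\<And>m. x m \<in> carrier_vec N" and "j < N"
  shows "extrapolant N x k g $ j = (\<Sum>i=0..k. g $ i * x i $ j)"
proof -
  have "j < dim_vec (x i)" for i
    using assms(2) carrier_vecD[OF assms(1)] by simp
  then show ?thesis
    unfolding extrapolant_def using assms by (subst index_finsum_vec) (auto intro!: sum.cong)
qed

lemma extrapolant_snoc_vec_zero:
  assumes x: "\<And>m. x m \<in> carrier_vec N" and c: "c \<in> carrier_vec k" and k: "1 \<le> k"
  shows "extrapolant N x k (snoc_vec c 0) = extrapolant N x (k - 1) c"
proof (rule eq_vecI)
  fix j assume "j < dim_vec (extrapolant N x (k - 1) c)"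
  then have j: "j < N"
    by (simp add: carrier_vecD[OF extrapolant_carrier[OF x]])
  show "extrapolant N x k (snoc_vec c 0) $ j = extrapolant N x (k - 1) c $ j"
    using sum_snoc_vec[OF c k, of "\<lambda>i a. a * x i $ j" 0]
    by (simp add: extrapolant_index[OF x j])
qed (simp add: carrier_vecD[OF extrapolant_carrier[OF x]])

lemma extrapolant_linear:
  assumes x: "\<And>m. x m \<in> carrier_vec N" and g: "g \<in> carrier_vec (k + 1)" and h: "h \<in> carrier_vec (k + 1)"
  shows "extrapolant N x k (a \<cdot>\<^sub>v g + b \<cdot>\<^sub>v h) = a \<cdot>\<^sub>v extrapolant N x k g + b \<cdot>\<^sub>v extrapolant N x k h"
proof (rule eq_vecI)
  have dim: "dim_vec (extrapolant N x k f) = N" for f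
    by (rule carrier_vecD[OF extrapolant_carrier[OF x]])
  show "dim_vec (extrapolant N x k (a \<cdot>\<^sub>v g + b \<cdot>\<^sub>v h)) =
      dim_vec (a \<cdot>\<^sub>v extrapolant N x k g + b \<cdot>\<^sub>v extrapolant N x k h)"
    by (simp add: dim)
  fix j assume "j < dim_vec (a \<cdot>\<^sub>v extrapolant N x k g + b \<cdot>\<^sub>v extrapolant N x k h)"
  then have j: "j < N"
    by (simp add: dim)
  have "(\<Sum>i=0..k. (a \<cdot>\<^sub>v g + b \<cdot>\<^sub>v h) $ i * x i $ j) =
      (\<Sum>i=0..k. a * (g $ i * x i $ j) + b * (h $ i * x i $ j))"
    using g h by (intro sum.cong) (auto simp: algebra_simps)
  then show "extrapolant N x k (a \<cdot>\<^sub>v g + b \<cdot>\<^sub>v h) $ j =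
      (a \<cdot>\<^sub>v extrapolant N x k g + b \<cdot>\<^sub>v extrapolant N x k h) $ j"
    using j by (simp add: extrapolant_index[OF x j] dim sum.distrib sum_distrib_left)
qed


section \<open>The two coefficient vectors\<close>

context pos_def_mat
begin

text \<open>The constraint is encoded by the vector of ones. The second part is how $\gamma_k^{RRE}$ gets
  identified: no minimization has to be carried out, only orthogonality has to be checked.\<close>

lemma
  assumes rank: "vec_space.rank N (diff_mat N x k) = k + 1"
  shows rre_gamma_stationary: "stationary M (diff_mat N x k) (ones (k + 1)) (rre_gamma N M x k)"
    and rre_gamma_unique:
      "stationary M (diff_mat N x k) (ones (k + 1)) g \<Longrightarrow> rre_gamma N M x k = g"
proof -
  note A = diff_mat_carrier[of N x k]
  note inj = full_column_rank_injective[OF A rank]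
  show unique: "rre_gamma N M x k = g" if g: "stationary M (diff_mat N x k) (ones (k + 1)) g" for g
    unfolding rre_gamma_def
  proof (rule the_is_arg_min_eq)
    show "g \<in> carrier_vec (k + 1) \<and> (\<Sum>i=0..k. g $ i) = 1"
      using g A ones_scalar_prod[of g k] by (auto simp: stationary_def)
    show "m_norm M (diff_mat N x k *\<^sub>v g) < m_norm M (diff_mat N x k *\<^sub>v h)"
      if "h \<in> carrier_vec (k + 1) \<and> (\<Sum>i=0..k. h $ i) = 1" "h \<noteq> g" for h
      using that ones_scalar_prod[of h k]
      by (intro stationary_strict_min[OF A inj _ g]) auto
  qed
  obtain g where "stationary M (diff_mat N x k) (ones (k + 1)) g"
    using stationary_exists[OF A inj _ ones_nonzero] by auto
  with unique show "stationary M (diff_mat N x k) (ones (k + 1)) (rre_gamma N M x k)"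
    by simp
qed

text \<open>The unconstrained problem in \<open>k\<close> unknowns is the problem in \<open>k + 1\<close> unknowns whose last entry
  is constrained to be 1, which is why the last unit vector appears.\<close>

lemma mpe_c_stationary:
  assumes x: "\<And>m. x m \<in> carrier_vec N" and k: "1 \<le> k"
    and rank: "vec_space.rank N (diff_mat N x k) = k + 1"
  shows "stationary M (diff_mat N x k) (unit_vec (k + 1) k) (mpe_c N M x k)"
proof -
  note A = diff_mat_carrier[of N x k]
  note inj = full_column_rank_injective[OF A rank]
  have e: "unit_vec (k + 1) k \<noteq> (0\<^sub>v (k + 1) :: complex vec)"
    by simp
  obtain g where g: "stationary M (diff_mat N x k) (unit_vec (k + 1) k) g"
    using stationary_exists[OF A inj unit_vec_carrier e] by auto
  then have gk: "g \<in> carrier_vec (k + 1)" "g $ k = 1"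
    using A unit_vec_last_scalar_prod[of g k] by (auto simp: stationary_def)
  then obtain c where c: "c \<in> carrier_vec k" "g = snoc_vec c 1"
    using snoc_vec_cases by metis
  have res: "diff_mat N x k *\<^sub>v snoc_vec d 1 = diff_mat N x (k - 1) *\<^sub>v d + diff_vec x k"
    if "d \<in> carrier_vec k" for d
    using diff_mat_mult_snoc_vec[where x = x, OF x that k, where t = 1] by simp
  have "mpe_min N M x k = c"
    unfolding mpe_min_def
  proof (rule the_is_arg_min_eq)
    show "m_norm M (diff_mat N x (k - 1) *\<^sub>v c + diff_vec x k)
        < m_norm M (diff_mat N x (k - 1) *\<^sub>v d + diff_vec x k)"
      if d: "d \<in> carrier_vec k" "d \<noteq> c" for d
    proof -
      have "unit_vec (k + 1) k \<bullet> snoc_vec d 1 = 1"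
        by (simp only: unit_vec_last_scalar_prod[OF snoc_vec_carrier[OF d(1)]] snoc_vec_last[OF d(1)])
      then have "m_norm M (diff_mat N x k *\<^sub>v g) < m_norm M (diff_mat N x k *\<^sub>v snoc_vec d 1)"
        using d c snoc_vec_inject[of d k c 1]
        by (intro stationary_strict_min[OF A inj _ g]) auto
      then show ?thesis
        using c d by (simp add: res)
    qed
  qed (rule c)
  then have "mpe_c N M x k = g"
    using c by (auto simp: mpe_c_def snoc_vec_def)
  with g show ?thesis
    by simp
qed

end


section \<open>The relation between the two methods\<close>

text \<open>Division by \<open>P * Q / (P + Q)\<close> turns the weights \<open>Q / (P + Q)\<close> and \<open>P / (P + Q)\<close> into \<open>1 / P\<close> and
  \<open>1 / Q\<close>. It serves both the residuals and the extrapolants.\<close>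

lemma weighted_mean_scaled:
  fixes P Q :: real
  assumes "0 < P" "0 < Q" and p: "p \<in> carrier_vec N" and q: "q \<in> carrier_vec N"
  shows "complex_of_real (1 / (P * Q / (P + Q))) \<cdot>\<^sub>v
      (complex_of_real (Q / (P + Q)) \<cdot>\<^sub>v p + complex_of_real (P / (P + Q)) \<cdot>\<^sub>v q) =
    complex_of_real (1 / P) \<cdot>\<^sub>v p + complex_of_real (1 / Q) \<cdot>\<^sub>v q"
proof -
  have "1 / (P * Q / (P + Q)) * (Q / (P + Q)) = 1 / P"
    "1 / (P * Q / (P + Q)) * (P / (P + Q)) = 1 / Q"
    using assms(1,2) by (simp_all add: field_simps add_pos_pos less_imp_neq[symmetric])
  then show ?thesis
    using p q
    by (simp only: smult_add_distrib_vec[of _ N] smult_carrier_vec smult_smult_assoc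
        of_real_mult[symmetric])
qed

context pos_def_mat
begin

text \<open>The heart of the proof. The weights are forced: every vector of entry sum 1 on the line through
  the two given ones is a mean of them, and its image \<open>\<alpha>p + \<beta>q\<close> is orthogonal to \<open>q - p\<close> only if
  \<open>\<alpha>P = \<beta>Q\<close>.\<close>

lemma rre_gamma_weighted_mean:
  assumes x: "\<And>m. x m \<in> carrier_vec N" and k: "1 \<le> k"
    and rank: "vec_space.rank N (diff_mat N x k) = k + 1"
    and rank': "vec_space.rank N (diff_mat N x (k - 1)) = k"
    and ex: "mpe_exists N M x k"
  defines "P \<equiv> (m_norm M (rre_res N M x (k - 1)))\<^sup>2" and "Q \<equiv> (m_norm M (mpe_res N M x k))\<^sup>2"
  shows "0 < P" and "0 < Q"
    and "rre_gamma N M x (k - 1) \<in> carrier_vec k"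
    and "mpe_gamma N M x k \<in> carrier_vec (k + 1)"
    and "m_inner M (rre_res N M x (k - 1)) (mpe_res N M x k) = 0"
    and "rre_gamma N M x k =
      complex_of_real (Q / (P + Q)) \<cdot>\<^sub>v snoc_vec (rre_gamma N M x (k - 1)) 0 +
      complex_of_real (P / (P + Q)) \<cdot>\<^sub>v mpe_gamma N M x k"
proof -
  define U where "U = diff_mat N x k"
  define V where "V = diff_mat N x (k - 1)"
  define c where "c = mpe_c N M x k"
  define S where "S = (\<Sum>i=0..k. c $ i)"
  define a where "a = rre_gamma N M x (k - 1)"
  define b where "b = mpe_gamma N M x k"
  define p where "p = rre_res N M x (k - 1)"
  define q where "q = mpe_res N M x k"
  have U: "U \<in> carrier_mat N (k + 1)" and V: "V \<in> carrier_mat N k"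
    using k diff_mat_carrier[of N x k] diff_mat_carrier[of N x "k - 1"] by (simp_all add: U_def V_def)
  have dimU: "dim_col U = k + 1" and dimV: "dim_col V = k"
    using U V by auto
  have injU: "v = 0\<^sub>v (k + 1)" if "v \<in> carrier_vec (k + 1)" "U *\<^sub>v v = 0\<^sub>v N" for v
    using full_column_rank_injective[OF U _ that] rank by (simp add: U_def)
  have injV: "v = 0\<^sub>v k" if "v \<in> carrier_vec k" "V *\<^sub>v v = 0\<^sub>v N" for v
    using full_column_rank_injective[OF V _ that] rank' by (simp add: V_def)
  have Usnoc: "U *\<^sub>v snoc_vec d 0 = V *\<^sub>v d" if "d \<in> carrier_vec k" for d
    unfolding U_def V_def by (rule diff_mat_mult_snoc_vec_zero[where x = x, OF x that k])
  have "k - 1 + 1 = k"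
    using k by simp
  note sa = rre_gamma_stationary[where x = x and k = "k - 1", unfolded this, OF rank',
      folded V_def a_def]
  from sa have a: "a \<in> carrier_vec k" "ones k \<bullet> a = 1"
    by (auto simp: stationary_def dimV)
  have sc: "stationary M U (unit_vec (k + 1) k) c"
    using mpe_c_stationary[where x = x, OF x k rank] by (simp add: U_def c_def)
  then have c: "c \<in> carrier_vec (k + 1)"
    by (auto simp: stationary_def dimU)
  then have ck: "c $ k = 1"
    using sc unit_vec_last_scalar_prod[of c k] by (simp add: stationary_def)
  have S: "S \<noteq> 0"
    using ex by (simp add: mpe_exists_def S_def c_def)
  have bc: "b = (1 / S) \<cdot>\<^sub>v c"
    unfolding b_def mpe_gamma_def using c by (auto simp: S_def c_def)
  have b: "b \<in> carrier_vec (k + 1)" "b $ k = 1 / S"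
    using c ck by (simp_all add: bc)
  have pV: "p = V *\<^sub>v a" and qU: "q = U *\<^sub>v b"
    by (simp_all add: p_def V_def a_def rre_res_def q_def U_def b_def mpe_res_def)
  have p: "p \<in> carrier_vec N" and q: "q \<in> carrier_vec N"
    using U V a b by (auto simp: pV qU)
  \<comment> \<open>The MPE residual is orthogonal to the first \<open>k\<close> columns.\<close>
  have orth_q: "m_inner M (V *\<^sub>v d) q = 0" if d: "d \<in> carrier_vec k" for d
  proof -
    have "unit_vec (k + 1) k \<bullet> snoc_vec d 0 = 0"
      by (simp only: unit_vec_last_scalar_prod[OF snoc_vec_carrier[OF d]] snoc_vec_last[OF d])
    then have "m_inner M (U *\<^sub>v snoc_vec d 0) (U *\<^sub>v c) = 0"
      using sc d by (simp add: stationary_def dimU)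
    then show ?thesis
      using U V c d by (simp add: Usnoc qU bc mult_mat_vec[OF U] m_inner_smult_right)
  qed
  have sum_snoc: "ones (k + 1) \<bullet> snoc_vec d 0 = ones k \<bullet> d" if "d \<in> carrier_vec k" for d
    using that sum_snoc_vec[OF that k, of "\<lambda>i a. a" 0] k ones_scalar_prod[of d "k - 1"]
      ones_scalar_prod[OF snoc_vec_carrier[OF that], of 0]
    by simp
  have sum_b: "ones (k + 1) \<bullet> b = 1"
    using c S ones_scalar_prod[OF c] by (simp add: bc S_def)
  note sums = sum_snoc[unfolded Suc_eq_plus1[symmetric]] sum_b[unfolded Suc_eq_plus1[symmetric]]
  have "a \<noteq> 0\<^sub>v k"
    using a by auto
  then have "p \<noteq> 0\<^sub>v N"
    using injV a by (auto simp: pV)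
  then show P: "0 < P"
    using m_norm_pos[OF p] by (simp add: P_def p_def)
  have "b \<noteq> 0\<^sub>v (k + 1)"
    using sum_b by auto
  then have "q \<noteq> 0\<^sub>v N"
    using injU b by (auto simp: qU)
  then show Q: "0 < Q"
    using m_norm_pos[OF q] by (simp add: Q_def q_def)
  show "rre_gamma N M x (k - 1) \<in> carrier_vec k" "mpe_gamma N M x k \<in> carrier_vec (k + 1)"
    using a b by (simp_all add: a_def b_def)
  show pq: "m_inner M (rre_res N M x (k - 1)) (mpe_res N M x k) = 0"
    using orth_q[OF a(1)] unfolding p_def[symmetric] q_def[symmetric] pV .
  then have pq: "m_inner M p q = 0"
    unfolding p_def q_def .
  then have qp: "m_inner M q p = 0"
    using m_inner_commute[OF q p] by simp
  have pp: "m_inner M p p = of_real P" and qq: "m_inner M q q = of_real Q"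
    using m_inner_self[OF p] m_inner_self[OF q] by (simp_all add: P_def p_def Q_def q_def)
  define \<alpha> where "\<alpha> = complex_of_real (Q / (P + Q))"
  define \<beta> where "\<beta> = complex_of_real (P / (P + Q))"
  have "Q / (P + Q) + P / (P + Q) = 1"
    using P Q by (simp add: add_divide_distrib[symmetric] add.commute)
  then have ab1: "\<alpha> + \<beta> = 1"
    unfolding \<alpha>_def \<beta>_def of_real_add[symmetric] by simp
  have abPQ: "\<alpha> * of_real P = \<beta> * of_real Q"
    unfolding \<alpha>_def \<beta>_def of_real_mult[symmetric] by (simp add: mult.commute)
  define g where "g = \<alpha> \<cdot>\<^sub>v snoc_vec a 0 + \<beta> \<cdot>\<^sub>v b"
  have g: "g \<in> carrier_vec (k + 1)"
    using a b by (simp add: g_def)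
  have Ug: "U *\<^sub>v g = \<alpha> \<cdot>\<^sub>v p + \<beta> \<cdot>\<^sub>v q"
    using a b by (simp add: g_def mult_add_distrib_mat_vec[OF U] mult_mat_vec[OF U] Usnoc pV qU)
  have "stationary M U (ones (k + 1)) g"
    unfolding stationary_def dimU
  proof (intro conjI ballI impI)
    show "ones (k + 1) \<bullet> g = 1"
      using a b ab1 by (simp add: g_def scalar_prod_add_distrib[of _ "k + 1"] sums)
    fix d assume d: "d \<in> carrier_vec (k + 1)" and sum_d: "ones (k + 1) \<bullet> d = 0"
    \<comment> \<open>The last entry of \<open>b\<close> is \<open>1 / S\<close> and that of the extended \<open>a\<close> is 0, so subtracting \<open>S * d $ k\<close>
      times their difference makes the last entry of \<open>d\<close> vanish and keeps its entry sum 0.\<close>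
    define t where "t = S * d $ k"
    define f where "f = d + t \<cdot>\<^sub>v (snoc_vec a 0 - b)"
    have f: "f \<in> carrier_vec (k + 1)" "f $ k = 0"
      using d a b S by (simp_all add: f_def t_def snoc_vec_last carrier_vecD)
    then obtain f' where f': "f' \<in> carrier_vec k" "f = snoc_vec f' 0"
      using snoc_vec_cases[OF f(1)] f(2) by metis
    have "ones (k + 1) \<bullet> f = 0"
      using d a b sum_d
      by (simp add: f_def scalar_prod_add_distrib[of _ "k + 1"] scalar_prod_minus_distrib[of _ "k + 1"]
          sums)
    then have "ones k \<bullet> f' = 0"
      using f' by (simp add: sums)
    then have f'p: "m_inner M (V *\<^sub>v f') p = 0"
      using sa f' by (simp add: stationary_def dimV pV)
    have "d = snoc_vec f' 0 + (t \<cdot>\<^sub>v b + (- t) \<cdot>\<^sub>v snoc_vec a 0)"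
      unfolding f'(2)[symmetric] f_def
      by (intro eq_vecI) (simp_all add: carrier_vecD[OF d] carrier_vecD[OF b(1)]
          carrier_vecD[OF snoc_vec_carrier[OF a(1)]] algebra_simps)
    then have Ud: "U *\<^sub>v d = V *\<^sub>v f' + (t \<cdot>\<^sub>v q + (- t) \<cdot>\<^sub>v p)"
      using a b f' by (simp add: mult_add_distrib_mat_vec[OF U] mult_mat_vec[OF U] Usnoc pV qU)
    have Vf: "V *\<^sub>v f' \<in> carrier_vec N"
      using V f' by simp
    show "m_inner M (U *\<^sub>v d) (U *\<^sub>v g) = 0"
      unfolding Ud Ug using p q Vf f'p orth_q[OF f'(1)] pq qp pp qq abPQ
      by (simp add: m_inner_add_left m_inner_add_right m_inner_smult_left m_inner_smult_right
          algebra_simps)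
  qed (rule g)
  then show "rre_gamma N M x k =
      complex_of_real (Q / (P + Q)) \<cdot>\<^sub>v snoc_vec (rre_gamma N M x (k - 1)) 0 +
      complex_of_real (P / (P + Q)) \<cdot>\<^sub>v mpe_gamma N M x k"
    using rre_gamma_unique[OF rank] by (simp add: U_def g_def \<alpha>_def \<beta>_def a_def b_def)
qed

end

theorem theorem2:
  fixes N k k0 :: nat and M :: "complex mat" and x :: "nat \<Rightarrow> complex vec"
  assumes "hermitian_pos_def N M"
    and "\<And>m. x m \<in> carrier_vec N"
    and "is_break_index N x k0"
    and "1 \<le> k" and "k < k0"
    and "mpe_exists N M x k"
  shows "1 / (m_norm M (rre_res N M x k))\<^sup>2 =
           1 / (m_norm M (rre_res N M x (k - 1)))\<^sup>2 + 1 / (m_norm M (mpe_res N M x k))\<^sup>2 \<and>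
         complex_of_real (1 / (m_norm M (rre_res N M x k))\<^sup>2) \<cdot>\<^sub>v rre_res N M x k =
           complex_of_real (1 / (m_norm M (rre_res N M x (k - 1)))\<^sup>2) \<cdot>\<^sub>v rre_res N M x (k - 1) +
           complex_of_real (1 / (m_norm M (mpe_res N M x k))\<^sup>2) \<cdot>\<^sub>v mpe_res N M x k \<and>
         complex_of_real (1 / (m_norm M (rre_res N M x k))\<^sup>2) \<cdot>\<^sub>v rre_s N M x k =
           complex_of_real (1 / (m_norm M (rre_res N M x (k - 1)))\<^sup>2) \<cdot>\<^sub>v rre_s N M x (k - 1) +
           complex_of_real (1 / (m_norm M (mpe_res N M x k))\<^sup>2) \<cdot>\<^sub>v mpe_s N M x k \<and>
         m_norm M (rre_res N M x k) < m_norm M (rre_res N M x (k - 1))"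
proof -
  interpret pos_def_mat N M
    by standard (rule assms(1))
  note x = assms(2) and k = assms(4)
  have rank: "vec_space.rank N (diff_mat N x k) = k + 1"
    and rank': "vec_space.rank N (diff_mat N x (k - 1)) = k"
    using assms(3-5) unfolding is_break_index_def by force+
  define p where "p = rre_res N M x (k - 1)"
  define q where "q = mpe_res N M x k"
  define P where "P = (m_norm M p)\<^sup>2"
  define Q where "Q = (m_norm M q)\<^sup>2"
  define \<alpha> where "\<alpha> = complex_of_real (Q / (P + Q))"
  define \<beta> where "\<beta> = complex_of_real (P / (P + Q))"
  note mean = rre_gamma_weighted_mean[where x = x, OF x k rank rank' assms(6),
      folded p_def q_def, folded P_def Q_def, folded \<alpha>_def \<beta>_def]
  note P = mean(1) and Q = mean(2) and a = mean(3) and b = mean(4) and orth = mean(5)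
    and gamma = mean(6)
  note U = diff_mat_carrier[of N x k]
  have p: "p \<in> carrier_vec N" and q: "q \<in> carrier_vec N"
    using k a b diff_mat_carrier[of N x "k - 1"] U
    by (auto simp: p_def q_def rre_res_def mpe_res_def)
  have p_snoc: "diff_mat N x k *\<^sub>v snoc_vec (rre_gamma N M x (k - 1)) 0 = p"
    unfolding p_def rre_res_def by (rule diff_mat_mult_snoc_vec_zero[where x = x, OF x a k])
  have res: "rre_res N M x k = \<alpha> \<cdot>\<^sub>v p + \<beta> \<cdot>\<^sub>v q"
    unfolding rre_res_def gamma using a b
    by (simp add: mult_add_distrib_mat_vec[OF U] mult_mat_vec[OF U] p_snoc[unfolded One_nat_def])
      (simp add: q_def mpe_res_def)
  have s: "rre_s N M x k = \<alpha> \<cdot>\<^sub>v rre_s N M x (k - 1) + \<beta> \<cdot>\<^sub>v mpe_s N M x k"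
    unfolding rre_s_def mpe_s_def gamma
    by (simp add: extrapolant_linear[OF x snoc_vec_carrier[OF a] b]
        extrapolant_snoc_vec_zero[OF x a k] del: One_nat_def)
  have "(m_norm M (rre_res N M x k))\<^sup>2 = (Q / (P + Q))\<^sup>2 * P + (P / (P + Q))\<^sup>2 * Q"
  proof -
    have "m_inner M (rre_res N M x k) (rre_res N M x k) =
        complex_of_real ((Q / (P + Q))\<^sup>2 * P + (P / (P + Q))\<^sup>2 * Q)"
      unfolding res using p q orth m_inner_commute[OF q p] m_inner_self[OF p] m_inner_self[OF q]
      by (simp add: m_inner_add_left m_inner_add_right m_inner_smult_left m_inner_smult_right
          \<alpha>_def \<beta>_def P_def Q_def power2_eq_square mult.assoc)
    then show ?thesis
      using p q res by (simp add: m_norm_power2)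
  qed
  also have "\<dots> = P * Q * (P + Q) / (P + Q)\<^sup>2"
    by (simp add: power_divide add_divide_distrib[symmetric] power2_eq_square algebra_simps)
  also have "\<dots> = P * Q / (P + Q)"
    by (simp add: power2_eq_square)
  finally have R: "(m_norm M (rre_res N M x k))\<^sup>2 = P * Q / (P + Q)" .
  have recip: "1 / (P * Q / (P + Q)) = 1 / P + 1 / Q"
    using P Q by (simp add: field_simps)
  have "P * Q / (P + Q) < P"
    using P Q by (simp add: field_simps)
  then have "(m_norm M (rre_res N M x k))\<^sup>2 < (m_norm M p)\<^sup>2"
    by (simp only: R P_def)
  then have "m_norm M (rre_res N M x k) < m_norm M p"
    using m_norm_nonneg[OF p] by (rule power_less_imp_less_base)
  moreover have "complex_of_real (1 / (P * Q / (P + Q))) \<cdot>\<^sub>v rre_res N M x k =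
      complex_of_real (1 / P) \<cdot>\<^sub>v p + complex_of_real (1 / Q) \<cdot>\<^sub>v q"
    unfolding res \<alpha>_def \<beta>_def by (rule weighted_mean_scaled[OF P Q p q])
  moreover have "complex_of_real (1 / (P * Q / (P + Q))) \<cdot>\<^sub>v rre_s N M x k =
      complex_of_real (1 / P) \<cdot>\<^sub>v rre_s N M x (k - 1) + complex_of_real (1 / Q) \<cdot>\<^sub>v mpe_s N M x k"
    unfolding s \<alpha>_def \<beta>_def unfolding rre_s_def mpe_s_def
    by (rule weighted_mean_scaled[OF P Q extrapolant_carrier[where x = x, OF x]
          extrapolant_carrier[where x = x, OF x]])
  ultimately show ?thesis
    unfolding R p_def[symmetric] q_def[symmetric] P_def[symmetric] Q_def[symmetric]
    by (intro conjI recip)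
qed

end
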